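(* Let $n,d\ge 1$, let $f_1,\dots,f_n:\mathbb{R}^d\to\mathbb{R}$ and $f=\frac1n\sum_{i=1}^n f_i$. Let $\mu,\Lambda>0$ be constants such that: (i) each $f_i$ is convex and twice continuously differentiable; (ii) $\mu I\preceq\nabla^2 f(w)\preceq\Lambda I$ for all $w\in\mathbb{R}^d$; (iii) each $\nabla f_i$ is $\Lambda$-Lipschitz, i.e. $\|\nabla f_i(w_a)-\nabla f_i(w_b)\|\le\Lambda\|w_a-w_b\|$ for all $w_a,w_b\in\mathbb{R}^d$. Let $w_*$ be the unique minimizer of $f$. Let $(\tilde w_\tau)_{\tau\ge 0}$ be the random sequence generated by the Nyström-SVRG algorithm (described in the context) applied to $f$, with initial point $\tilde w_0$, step size $\eta>0$, regularization parameter $\rho>0$ and $\ell\ge1$ inner iterations per epoch. Suppose that $\Gamma\geq 0$ is a constant such that the Nyström approximations $N_\tau$ used by the algorithm satisfy $0\preceq N_\tau\preceq\Gamma I$ for every epoch $\tau$. Put $$\Delta=\frac{1}{\Gamma+\rho},\qquad \delta=\frac1\rho,$$ and assume that $\eta<\dfrac{\mu\Delta}{2\Lambda^2\delta^2}$ and that $\ell$ is large enough that $$\frac{1}{2\ell\eta}+2\eta\Lambda^2\delta^2<\mu\Delta .$$ Then, with $$\alpha=\frac{1+2\ell\eta^2\Lambda^2\delta^2}{2\ell\eta\,(\mu\Delta-\eta\Lambda^2\delta^2)},$$ one has $\alpha<1$ and, for all $\tau\ge 0$, $$\mathbb{E}\big[f(\tilde w_\tau)-f(w_* )\big]\le\alpha^\tau\,\mathbb{E}\big[f(\tilde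 w_0)-f(w_* )\big].$$
   Context: $\|\cdot\|$ is the Euclidean norm and $A\preceq B$ means $B-A$ is positive semidefinite. For a nonempty batch $\mathcal{B}\subseteq\{1,\dots,n\}$, $f_{\mathcal{B}}=\frac{1}{|\mathcal{B}|}\sum_{i\in\mathcal{B}}f_i$. Nyström approximation. Let $H\in\mathbb{R}^{d\times d}$ be symmetric positive semidefinite, let $\Omega\subset\{1,\dots,d\}$ with $|\Omega|=m$, and let $k\le m$. Let $C\in\mathbb{R}^{d\times m}$ consist of the columns of $H$ indexed by $\Omega$, let $M\in\mathbb{R}^{m\times m}$ be the submatrix of $H$ formed by the rows and columns indexed by $\Omega$, let $M_k$ be a best rank-$k$ approximation of $M$ (from its singular value decomposition), and let $M_k^\dagger$ be its pseudo-inverse. The rank-$k$ Nyström approximation of $H$ is $N=CM_k^\dagger C^\top$, a symmetric positive semidefinite matrix. Nyström-SVRG algorithm. Inputs: initial point $\tilde w_0\in\mathbb{R}^d$, step size $\eta>0$, regularization $\rho>0$, number of inner iterations $\ell\ge1$, number of columns $m$, rank $k$, batch size. For each epoch $\tau=1,2,\dots$: 1. Set $\tilde w=\tilde w_{\tau-1}$ and $\tilde g=\nabla f(\tilde w)=\frac1n\sum_{i=1}^n\nabla f_i(\tilde w)$. 2. Sample $\Omega\subset\{1,\dots,d\}$ with $|\Omega|=m$ uniformly at random, let $N_\tau$ be the rank-$k$ Nyström approximation of $\nabla^2 f(\tilde w)$ built from the columns in $\Omega$, and set $B_\tau=(N_\tau+\rho I)^{-1}$. 3. Set $w_0=\tilde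 w$. For $t=1,\dots,\ell$: draw a batch $\mathcal{B}\subseteq\{1,\dots,n\}$ of the prescribed size uniformly at random, independently of everything drawn so far; set $v_{t-1}=\nabla f_{\mathcal{B}}(w_{t-1})-\nabla f_{\mathcal{B}}(\tilde w)+\tilde g$ and $w_t=w_{t-1}-\eta B_\tau v_{t-1}$. 4. Set $\tilde w_\tau=w_t$ for $t$ chosen uniformly at random from $\{1,\dots,\ell\}$, independently of everything else. $\mathbb{E}$ denotes expectation over all random choices made by the algorithm. *)

theory Defs
  imports "HOL-Probability.Probability"
begin

definition gradient :: "(real^'d \<Rightarrow> real) \<Rightarrow> real^'d \<Rightarrow> real^'d" where
  "gradient f w = (THE D. GDERIV f w :> D)"

definition hessian :: "(real^'d \<Rightarrow> real) \<Rightarrow> real^'d \<Rightarrow> real^'d^'d" where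
  "hessian f w = jacobian (gradient f) (at w)"

definition twice_continuously_differentiable :: "(real^'d \<Rightarrow> real) \<Rightarrow> bool" where
  "twice_continuously_differentiable f \<longleftrightarrow>
     (\<forall>w. f differentiable (at w)) \<and>
     (\<forall>w. gradient f differentiable (at w)) \<and>
     continuous_on UNIV (hessian f)"

definition psd :: "real^'d^'d \<Rightarrow> bool" where
  "psd A \<longleftrightarrow> transpose A = A \<and> (\<forall>x. 0 \<le> inner x (A *v x))"

definition loewner_le :: "real^'d^'d \<Rightarrow> real^'d^'d \<Rightarrow> bool" where
  "loewner_le A B \<longleftrightarrow> psd (B - A)"

definition batch_mean :: "(nat \<Rightarrow> real^'d \<Rightarrow> real) \<Rightarrow> nat set \<Rightarrow> real^'d \<Rightarrow> real" where
  "batch_mean F B w = (1 / real (card B)) * (\<Sum>i\<in>B. F i w)"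

definition diag_matrix :: "real^'m \<Rightarrow> real^'m^'m" where
  "diag_matrix s = (\<chi> i j. if i = j then s $ i else 0)"

(* The index type carries no order, so the k largest singular values are selected by a
   k-element index set S rather than by sorting.  Ties make the result non-unique,
   hence a relation rather than a function. *)
definition is_best_rank_approx :: "nat \<Rightarrow> real^'m^'m \<Rightarrow> real^'m^'m \<Rightarrow> bool" where
  "is_best_rank_approx k A Ak \<longleftrightarrow>
     (\<exists>U V s S.
        orthogonal_matrix U \<and> orthogonal_matrix V \<and> (\<forall>i. 0 \<le> s $ i) \<and>
        A = U ** diag_matrix s ** transpose V \<and>
        card S = k \<and> (\<forall>i\<in>S. \<forall>j. j \<notin> S \<longrightarrow> s $ j \<le> s $ i) \<and>
        Ak = U ** diag_matrix (\<chi> i. if i \<in> S then s $ i else 0) ** transpose V)"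

(* Moore-Penrose inverse: the four Penrose conditions. *)
definition is_pseudo_inverse :: "real^'m^'m \<Rightarrow> real^'m^'m \<Rightarrow> bool" where
  "is_pseudo_inverse A X \<longleftrightarrow>
     A ** X ** A = A \<and> X ** A ** X = X \<and>
     transpose (A ** X) = A ** X \<and> transpose (X ** A) = X ** A"

definition pseudo_inverse :: "real^'m^'m \<Rightarrow> real^'m^'m" where
  "pseudo_inverse A = (THE X. is_pseudo_inverse A X)"

(* c lists the selected columns: the set called Omega is the range of the injection c,
   and the number m of columns is CARD('m). *)
definition is_nystrom_approx ::
    "nat \<Rightarrow> ('m::finite \<Rightarrow> 'd::finite) \<Rightarrow> real^'d^'d \<Rightarrow> real^'d^'d \<Rightarrow> bool" where
  "is_nystrom_approx k c H N \<longleftrightarrow>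
     (let C = (\<chi> i j. H $ i $ c j) :: real^'m^'d;
          M = (\<chi> i j. H $ c i $ c j) :: real^'m^'m
      in \<exists>Mk. is_best_rank_approx k M Mk \<and> N = C ** pseudo_inverse Mk ** transpose C)"

(* Parameters: nys H Omega is the Nystrom approximation of H built from the columns in
   Omega, m the number of columns, b the batch size, n the number of summands,
   l the number of inner iterations. *)

definition precond :: "real \<Rightarrow> real^'d^'d \<Rightarrow> real^'d^'d" where
  "precond \<rho> N = matrix_inv (N + \<rho> *\<^sub>R mat 1)"

definition svrg_step ::
    "nat \<Rightarrow> (nat \<Rightarrow> real^'d \<Rightarrow> real) \<Rightarrow> real \<Rightarrow> real^'d^'d \<Rightarrow> real^'d \<Rightarrow> nat set \<Rightarrow> real^'d \<Rightarrow> real^'d" where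
  "svrg_step n F \<eta> P w' \<B> w =
     (let g = gradient (batch_mean F {1..n}) w';
          v = gradient (batch_mean F \<B>) w - gradient (batch_mean F \<B>) w' + g
      in w - \<eta> *\<^sub>R (P *v v))"

(* Law of the inner trajectory (w_0, ..., w_t); entries beyond t are irrelevant. *)
primrec svrg_inner ::
    "nat \<Rightarrow> nat \<Rightarrow> (nat \<Rightarrow> real^'d \<Rightarrow> real) \<Rightarrow> real \<Rightarrow> real^'d^'d \<Rightarrow> real^'d \<Rightarrow> nat
     \<Rightarrow> (nat \<Rightarrow> real^'d) pmf" where
  "svrg_inner n b F \<eta> P w' 0 = return_pmf (\<lambda>_. w')"
| "svrg_inner n b F \<eta> P w' (Suc t) =
     do {
       w \<leftarrow> svrg_inner n b F \<eta> P w' t;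
       \<B> \<leftarrow> pmf_of_set {\<B>. \<B> \<subseteq> {1..n} \<and> card \<B> = b};
       return_pmf (w(Suc t := svrg_step n F \<eta> P w' \<B> (w t)))
     }"

definition svrg_epoch ::
    "(real^'d^'d \<Rightarrow> 'd::finite set \<Rightarrow> real^'d^'d) \<Rightarrow> nat \<Rightarrow> nat \<Rightarrow> nat \<Rightarrow> (nat \<Rightarrow> real^'d \<Rightarrow> real)
     \<Rightarrow> real \<Rightarrow> real \<Rightarrow> nat \<Rightarrow> real^'d \<Rightarrow> (real^'d) pmf" where
  "svrg_epoch nys m n b F \<eta> \<rho> l w' =
     do {
       \<Omega> \<leftarrow> pmf_of_set {\<Omega>. card \<Omega> = m};
       let P = precond \<rho> (nys (hessian (batch_mean F {1..n}) w') \<Omega>);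
       w \<leftarrow> svrg_inner n b F \<eta> P w' l;
       t \<leftarrow> pmf_of_set {1..l};
       return_pmf (w t)
     }"

(* Law of the outer iterate after tau epochs. *)
primrec nystrom_svrg ::
    "(real^'d^'d \<Rightarrow> 'd::finite set \<Rightarrow> real^'d^'d) \<Rightarrow> nat \<Rightarrow> nat \<Rightarrow> nat \<Rightarrow> (nat \<Rightarrow> real^'d \<Rightarrow> real)
     \<Rightarrow> real \<Rightarrow> real \<Rightarrow> nat \<Rightarrow> real^'d \<Rightarrow> nat \<Rightarrow> (real^'d) pmf" where
  "nystrom_svrg nys m n b F \<eta> \<rho> l w0 0 = return_pmf w0"
| "nystrom_svrg nys m n b F \<eta> \<rho> l w0 (Suc \<tau>) =
     do {
       w' \<leftarrow> nystrom_svrg nys m n b F \<eta> \<rho> l w0 \<tau>;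
       svrg_epoch nys m n b F \<eta> \<rho> l w'
     }"

end

theory Submission
  imports Defs
begin

text \<open>
  Within an epoch, write \<open>A t\<close> for the expected suboptimality of the \<open>t\<close>-th inner iterate.
  The quadratic upper bound for \<open>f\<close> controls \<open>f\<close> after one step by
  \<open>f w - \<eta> * (g \<bullet> P v) + \<Lambda> / 2 * \<eta>\<^sup>2 * \<delta>\<^sup>2 * (norm v)\<^sup>2\<close>. Since \<open>v\<close> is unbiased and
  \<open>\<Delta> I \<le> P\<close>, the linear term is at most \<open>- \<eta> * \<Delta> * (norm g)\<^sup>2\<close> on average, which the
  Polyak-Lojasiewicz inequality turns into \<open>- 2 * \<eta> * \<mu> * \<Delta> * A t\<close>. Co-coercivity of the batch
  gradients bounds the mean of \<open>(norm v)\<^sup>2\<close> by \<open>4 * \<Lambda> * (A t + A 0)\<close>. Summing the resulting linear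
  recursion over the epoch gives the factor \<open>\<alpha>\<close>.
\<close>

section \<open>Gradients and first-order inequalities\<close>

lemma gradient_eqI:
  assumes "GDERIV f w :> D"
  shows "gradient f w = D"
proof -
  have "E = D" if "GDERIV f w :> E" for E
  proof -
    have "(\<lambda>h. h \<bullet> E) = (\<lambda>h. h \<bullet> D)"
      using that assms unfolding gderiv_def by (rule has_derivative_unique)
    then show ?thesis
      by (metis vector_eq_ldot)
  qed
  then show ?thesis
    unfolding gradient_def using assms by blast
qed

lemma GDERIV_gradient:
  assumes "f differentiable (at w)"
  shows "GDERIV f w :> gradient f w"
proof -
  obtain f' where f': "(f has_derivative f') (at w)"
    using assms unfolding differentiable_def by blast
  have "linear f'"
    using f' has_derivative_linear by blast
  \<comment> \<open>Riesz representation: the adjoint of the functional \<open>f'\<close>, applied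
    to 1, is the vector representing it.\<close>
  then have "f' = (\<lambda>h. h \<bullet> adjoint f' 1)"
    by (auto simp: adjoint_works)
  then have "GDERIV f w :> adjoint f' 1"
    using f' unfolding gderiv_def by metis
  then show ?thesis
    using gradient_eqI by metis
qed

lemma GDERIV_along_line:
  assumes "GDERIV f (x + t *\<^sub>R u) :> D"
  shows "((\<lambda>t. f (x + t *\<^sub>R u)) has_real_derivative D \<bullet> u) (at t)"
proof -
  have "((\<lambda>t. x + t *\<^sub>R u) has_derivative (\<lambda>s. s *\<^sub>R u)) (at t)"
    by (auto intro!: derivative_eq_intros)
  from diff_chain_at[OF this assms[unfolded gderiv_def]]
  show ?thesis
    by (simp add: has_field_derivative_def o_def inner_commute mult_commute_abs)
qed

text \<open>The descent lemma. Subtracting the linear and quadratic terms of the bound from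
  \<open>f\<close> along the segment leaves \<open>\<phi>\<close>, whose derivative is nonpositive
  by Cauchy-Schwarz and the Lipschitz estimate; comparing endpoint values takes the place of
  integration.\<close>

lemma lipschitz_gradient_upper_bound:
  fixes g :: "'a::real_inner \<Rightarrow> 'a"
  assumes g: "\<And>w. GDERIV f w :> g w" and lip: "L-lipschitz_on UNIV g"
  shows "f y \<le> f x + g x \<bullet> (y - x) + L / 2 * (norm (y - x))\<^sup>2"
proof -
  define u where "u = y - x"
  define \<phi> where "\<phi> t = f (x + t *\<^sub>R u) - t * (g x \<bullet> u) - L / 2 * t\<^sup>2 * (norm u)\<^sup>2" for t
  have "\<phi> 1 \<le> \<phi> 0"
  proof (rule DERIV_nonpos_imp_nonincreasing[of 0 1 \<phi>])
    fix t :: real assume t: "0 \<le> t" "t \<le> 1"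
    have "(\<phi> has_real_derivative g (x + t *\<^sub>R u) \<bullet> u - g x \<bullet> u - L * t * (norm u)\<^sup>2) (at t)"
      unfolding \<phi>_def by (auto intro!: derivative_eq_intros GDERIV_along_line[OF g])
    moreover have "g (x + t *\<^sub>R u) \<bullet> u - g x \<bullet> u \<le> L * t * (norm u)\<^sup>2"
    proof -
      have "(g (x + t *\<^sub>R u) - g x) \<bullet> u \<le> norm (g (x + t *\<^sub>R u) - g x) * norm u"
        by (rule norm_cauchy_schwarz)
      also have "norm (g (x + t *\<^sub>R u) - g x) \<le> L * (t * norm u)"
        using lipschitz_onD[OF lip, of "x + t *\<^sub>R u" x] t by (simp add: dist_norm)
      finally show ?thesis
        by (simp add: inner_diff_left power2_eq_square mult.assoc mult_right_mono)
    qed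
    ultimately show "\<exists>D. (\<phi> has_real_derivative D) (at t) \<and> D \<le> 0"
      by force
  qed simp
  then show ?thesis
    by (simp add: \<phi>_def u_def)
qed

lemma convex_on_above_tangent_plane:
  fixes g :: "'a::real_inner \<Rightarrow> 'a"
  assumes "convex_on UNIV f" and g: "GDERIV f x :> g x"
  shows "f x + g x \<bullet> (y - x) \<le> f y"
proof -
  define u where "u = y - x"
  define \<phi> where "\<phi> t = f (x + t *\<^sub>R u)" for t :: real
  have "convex_on UNIV \<phi>"
  proof (rule convex_onI)
    fix t a b :: real assume t: "0 < t" "t < 1"
    have "x + ((1 - t) *\<^sub>R a + t *\<^sub>R b) *\<^sub>R u
        = (1 - t) *\<^sub>R (x + a *\<^sub>R u) + t *\<^sub>R (x + b *\<^sub>R u)"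
      by (simp add: algebra_simps)
    then show "\<phi> ((1 - t) *\<^sub>R a + t *\<^sub>R b) \<le> (1 - t) * \<phi> a + t * \<phi> b"
      unfolding \<phi>_def using convex_onD[OF assms(1), of t] t by simp
  qed simp
  moreover have "(\<phi> has_real_derivative g x \<bullet> u) (at 0)"
    unfolding \<phi>_def using g by (intro GDERIV_along_line) simp
  ultimately have "\<phi> 1 - \<phi> 0 \<ge> (g x \<bullet> u) * (1 - 0)"
    by (intro convex_on_imp_above_tangent[of UNIV]) auto
  then show ?thesis
    by (simp add: \<phi>_def u_def)
qed

text \<open>
  Compare the tangent plane at \<open>x\<close> with the quadratic upper bound at \<open>y\<close>,
  both evaluated at the gradient step \<open>z\<close>.
\<close>

lemma gradient_difference_le_bregman:
  fixes g :: "'a::real_inner \<Rightarrow> 'a"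
  assumes g: "\<And>w. GDERIV f w :> g w" and lip: "L-lipschitz_on UNIV g"
    and "convex_on UNIV f" and "L > 0"
  shows "(norm (g y - g x))\<^sup>2 \<le> 2 * L * (f y - f x - g x \<bullet> (y - x))"
proof -
  define D where "D = g y - g x"
  define z where "z = y - (1 / L) *\<^sub>R D"
  have "f x + g x \<bullet> (z - x) \<le> f z"
    using convex_on_above_tangent_plane[OF assms(3) g] .
  also have "f z \<le> f y + g y \<bullet> (z - y) + L / 2 * (norm (z - y))\<^sup>2"
    using lipschitz_gradient_upper_bound[OF g lip] .
  also have "\<dots> = f y - (g y \<bullet> D) / L + (norm D)\<^sup>2 / (2 * L)"
    using \<open>L > 0\<close> by (simp add: z_def power_divide field_simps power2_eq_square)
  also have "g x \<bullet> (z - x) = g x \<bullet> (y - x) - (g x \<bullet> D) / L"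
    by (simp add: z_def inner_diff_right)
  finally have "(g y \<bullet> D - g x \<bullet> D) / L - (norm D)\<^sup>2 / (2 * L) \<le> f y - f x - g x \<bullet> (y - x)"
    by (simp add: diff_divide_distrib)
  also have "g y \<bullet> D - g x \<bullet> D = (norm D)\<^sup>2"
    by (simp add: D_def inner_diff_left[symmetric] dot_square_norm)
  finally show ?thesis
    using \<open>L > 0\<close> by (simp add: D_def field_simps)
qed

text \<open>Second-order Taylor expansion with Lagrange remainder along the segment from
  \<open>x\<close> to \<open>y\<close>; the Hessian bound is applied at the one intermediate
  point.\<close>

lemma hessian_lower_bound_imp_strongly_convex:
  assumes f: "\<And>w. f differentiable (at w)" "\<And>w. gradient f differentiable (at w)"
    and hess: "\<And>w. loewner_le (\<mu> *\<^sub>R mat 1) (hessian f w)"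
  shows "f x + gradient f x \<bullet> (y - x) + \<mu> / 2 * (norm (y - x))\<^sup>2 \<le> f y"
proof -
  define u where "u = y - x"
  define \<phi> where "\<phi> t = f (x + t *\<^sub>R u)" for t
  define \<phi>' where "\<phi>' t = gradient f (x + t *\<^sub>R u) \<bullet> u" for t
  define \<phi>'' where "\<phi>'' t = (hessian f (x + t *\<^sub>R u) *v u) \<bullet> u" for t
  \<comment> \<open>The derivative sequence in the form \<open>Taylor_up\<close> expects; beyond
    \<open>\<phi>\<close> and \<open>\<phi>'\<close> only the entry at index 2 is read.\<close>
  define d where "d k = (if k = (0::nat) then \<phi> else if k = 1 then \<phi>' else \<phi>'')" for k
  have 1: "(\<phi> has_real_derivative \<phi>' t) (at t)" for t
    unfolding \<phi>_def \<phi>'_def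
    using f by (intro GDERIV_along_line GDERIV_gradient) 
  have 2: "(\<phi>' has_real_derivative \<phi>'' t) (at t)" for t
  proof -
    have "(gradient f has_derivative (*v) (hessian f (x + t *\<^sub>R u))) (at (x + t *\<^sub>R u))"
      using f jacobian_works
      unfolding hessian_def by blast
    moreover have "((\<lambda>t. x + t *\<^sub>R u) has_derivative (\<lambda>s. s *\<^sub>R u)) (at t)"
      by (auto intro!: derivative_eq_intros)
    ultimately have "((\<lambda>t. gradient f (x + t *\<^sub>R u)) has_derivative
        (\<lambda>s. hessian f (x + t *\<^sub>R u) *v (s *\<^sub>R u))) (at t)"
      using diff_chain_at[of "\<lambda>t. x + t *\<^sub>R u" _ t "gradient f"] by (simp add: o_def)
    from has_derivative_inner_left[OF this, of u] show ?thesis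
      unfolding \<phi>'_def \<phi>''_def has_field_derivative_def
      by (simp add: matrix_vector_mult_scaleR mult_commute_abs)
  qed
  have "\<forall>k t. k < 2 \<and> 0 \<le> t \<and> t \<le> 1 \<longrightarrow> (d k has_real_derivative d (Suc k) t) (at t)"
    using 1 2 by (auto simp: d_def less_2_cases_iff)
  then obtain t where t: "\<phi> 1 = (\<Sum>k<2. d k 0 / fact k * (1 - 0) ^ k) + d 2 t / fact 2 * (1 - 0)\<^sup>2"
    using Taylor_up[of 2 d \<phi> 0 1 0] by (auto simp: d_def)
  have "\<mu> * (norm u)\<^sup>2 \<le> \<phi>'' t"
    using hess[of "x + t *\<^sub>R u"]
    by (auto simp: loewner_le_def psd_def \<phi>''_def matrix_vector_mult_diff_rdistrib
          scaleR_matrix_vector_assoc[symmetric] inner_diff_right dot_square_norm inner_commute)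
  with t show ?thesis
    by (simp add: d_def \<phi>_def \<phi>'_def u_def numeral_2_eq_2)
qed

text \<open>This amounts to minimising the quadratic lower bound over \<open>u\<close>. The minimum
  is never computed: \<open>v + \<mu> *\<^sub>R u\<close> completes the square, and its norm is
  nonnegative.\<close>

lemma polyak_lojasiewicz:
  fixes v :: "'a::real_inner"
  assumes "fx + v \<bullet> u + \<mu> / 2 * (norm u)\<^sup>2 \<le> fy" and "\<mu> > 0"
  shows "2 * \<mu> * (fx - fy) \<le> (norm v)\<^sup>2"
proof -
  have "0 \<le> (norm (v + \<mu> *\<^sub>R u))\<^sup>2"
    by simp
  also have "\<dots> = (norm v)\<^sup>2 + 2 * \<mu> * (v \<bullet> u + \<mu> / 2 * (norm u)\<^sup>2)"
    by (simp add: power2_norm_eq_inner inner_add_left inner_add_right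
        inner_commute[of u v] algebra_simps)
  also have "\<dots> \<le> (norm v)\<^sup>2 + 2 * \<mu> * (fy - fx)"
    using assms by (intro add_left_mono mult_left_mono) auto
  finally show ?thesis
    by (simp add: algebra_simps)
qed

section \<open>Bounds for the preconditioner\<close>

text \<open>With \<open>u\<close> the solution of \<open>A *v u = v\<close>, both bounds come from
  the quadratic form of \<open>A = N + \<rho> *\<^sub>R mat 1\<close>, without a spectral
  decomposition: the first from its lower bound at \<open>u\<close>, the second from expanding it at
  \<open>u - c *\<^sub>R v\<close>.\<close>

lemma precond_bounds:
  fixes N :: "real^'d^'d"
  assumes "loewner_le 0 N" and "loewner_le N (\<Gamma> *\<^sub>R mat 1)" and "\<rho> > 0"
  shows "norm (precond \<rho> N *v v) \<le> norm v / \<rho>"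
    and "(norm v)\<^sup>2 / (\<Gamma> + \<rho>) \<le> v \<bullet> (precond \<rho> N *v v)"
proof -
  define A where "A = N + \<rho> *\<^sub>R mat 1"
  have sym: "transpose A = A"
    using assms(1) by (auto simp: A_def loewner_le_def psd_def transpose_def vec_eq_iff mat_def)
  have Av: "A *v x = N *v x + \<rho> *\<^sub>R x" for x
    by (simp add: A_def matrix_vector_mult_add_rdistrib scaleR_matrix_vector_assoc[symmetric])
  have lower: "\<rho> * (norm x)\<^sup>2 \<le> x \<bullet> (A *v x)" for x
    using assms(1) by (simp add: loewner_le_def psd_def Av inner_add_right dot_square_norm)
  have upper: "x \<bullet> (A *v x) \<le> (\<Gamma> + \<rho>) * (norm x)\<^sup>2" for x
    using assms(2) by (simp add: loewner_le_def psd_def Av inner_add_right dot_square_norm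
        matrix_vector_mult_diff_rdistrib scaleR_matrix_vector_assoc[symmetric] inner_diff_right
        distrib_right)
  have "x = 0" if "A *v x = 0" for x
    using lower[of x] that \<open>\<rho> > 0\<close> by (simp add: mult_le_0_iff)
  then have "invertible A"
    unfolding invertible_left_inverse matrix_left_invertible_ker by blast
  then have "A ** matrix_inv A = mat 1"
    unfolding invertible_def matrix_inv_def by (metis (mono_tags, lifting) someI_ex)
  define u where "u = precond \<rho> N *v v"
  have Au: "A *v u = v"
    using \<open>A ** matrix_inv A = mat 1\<close>
    by (simp add: u_def precond_def A_def matrix_vector_mul_assoc)
  have "\<rho> * (norm u)\<^sup>2 \<le> norm u * norm v"
    using lower[of u] norm_cauchy_schwarz[of u v] by (simp add: Au)
  then have "norm u \<le> norm v / \<rho>"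
    using \<open>\<rho> > 0\<close> by (cases "u = 0") (simp_all add: power2_eq_square field_simps)
  then show "norm (precond \<rho> N *v v) \<le> norm v / \<rho>"
    by (simp add: u_def)
  show "(norm v)\<^sup>2 / (\<Gamma> + \<rho>) \<le> v \<bullet> (precond \<rho> N *v v)"
  proof (cases "\<Gamma> + \<rho> > 0")
    case True
    \<comment> \<open>Nonnegativity of the form at \<open>u - c *\<^sub>R v\<close> yields \<open>u
      \<bullet> v \<ge> (2 * c - c\<^sup>2 * (\<Gamma> + \<rho>)) * (norm v)\<^sup>2\<close>; this
      \<open>c\<close> maximises the right-hand side.\<close>
    define c where "c = 1 / (\<Gamma> + \<rho>)"
    have uAv: "u \<bullet> (A *v v) = (norm v)\<^sup>2"
      by (metis Au dot_lmul_matrix dot_square_norm inner_commute sym transpose_matrix_vector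
          vector_transpose_matrix)
    have "0 \<le> (u - c *\<^sub>R v) \<bullet> (A *v (u - c *\<^sub>R v))"
      using lower[of "u - c *\<^sub>R v"] \<open>\<rho> > 0\<close> by (smt (verit) mult_nonneg_nonneg zero_le_power2)
    also have "\<dots> = u \<bullet> v - 2 * c * (norm v)\<^sup>2 + c\<^sup>2 * (v \<bullet> (A *v v))"
      by (simp add: matrix_vector_mult_diff_distrib matrix_vector_mult_scaleR Au inner_diff_left
          inner_diff_right uAv dot_square_norm power2_eq_square[of c] algebra_simps)
    also have "c\<^sup>2 * (v \<bullet> (A *v v)) \<le> c\<^sup>2 * ((\<Gamma> + \<rho>) * (norm v)\<^sup>2)"
      using upper by (intro mult_left_mono) auto
    also have "c\<^sup>2 * ((\<Gamma> + \<rho>) * (norm v)\<^sup>2) = c * (norm v)\<^sup>2"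
      using True by (simp add: c_def power2_eq_square)
    finally show ?thesis
      by (simp add: c_def u_def inner_commute)
  next
    \<comment> \<open>The quotient is then nonpositive, at \<open>\<Gamma> + \<rho> = 0\<close> by
      the convention for division by zero, while \<open>u \<bullet> v\<close> is a value of the
      nonnegative form of \<open>A\<close>.\<close>
    case False
    have "0 \<le> u \<bullet> v"
      using lower[of u] \<open>\<rho> > 0\<close> Au by (smt (verit) mult_nonneg_nonneg zero_le_power2)
    moreover have "(norm v)\<^sup>2 / (\<Gamma> + \<rho>) \<le> 0"
      using False by (simp add: divide_nonneg_nonpos)
    ultimately show ?thesis
      by (simp add: u_def inner_commute)
  qed
qed

section \<open>Finitely supported laws and uniform batch sampling\<close>

text \<open>Finite support makes every real function integrable, so the tower rule holds for
  arbitrary \<open>h\<close>. The draws of the algorithm are all of this kind.\<close>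

lemma expectation_bind_pmf_finite:
  fixes h :: "'b \<Rightarrow> real"
  assumes "finite (set_pmf p)" and "\<And>x. x \<in> set_pmf p \<Longrightarrow> finite (set_pmf (q x))"
  shows "measure_pmf.expectation (bind_pmf p q) h =
    measure_pmf.expectation p (\<lambda>x. measure_pmf.expectation (q x) h)"
  using assms
  by (simp add: pmf_expectation_bind[of "set_pmf p"] integral_measure_pmf[of "set_pmf p"])

lemma expectation_pmf_mono_finite:
  fixes h :: "'a \<Rightarrow> real"
  assumes "finite (set_pmf p)" and "\<And>x. x \<in> set_pmf p \<Longrightarrow> h x \<le> h' x"
  shows "measure_pmf.expectation p h \<le> measure_pmf.expectation p h'"
  using assms by (intro integral_mono_AE integrable_measure_pmf_finite) (auto simp: AE_measure_pmf_iff)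

lemma subsets_of_card_nonempty:
  assumes "b \<le> card A"
  shows "{B. B \<subseteq> A \<and> card B = b} \<noteq> {}"
  using obtain_subset_with_card_n[OF assms] by blast

text \<open>Double counting: an index \<open>i\<close> of \<open>A\<close> lies in as many subsets
  of size \<open>b\<close> as \<open>A - {i}\<close> has subsets of size
  \<open>b - 1\<close>.\<close>

lemma sum_over_subsets_of_card:
  fixes a :: "'a \<Rightarrow> real"
  assumes "finite A" and "1 \<le> b"
  shows "(\<Sum>B | B \<subseteq> A \<and> card B = b. \<Sum>i\<in>B. a i) = real (card A - 1 choose (b - 1)) * (\<Sum>i\<in>A. a i)"
proof -
  have fin: "finite {B. B \<subseteq> A \<and> card B = b}"
    using assms(1) by simp
  have count: "card {B. B \<subseteq> A \<and> card B = b \<and> i \<in> B} = (card A - 1 choose (b - 1))" if "i \<in> A" for i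
  proof -
    have "bij_betw (insert i) {B. B \<subseteq> A - {i} \<and> card B = b - 1} {B. B \<subseteq> A \<and> card B = b \<and> i \<in> B}"
      using that assms
      by (intro bij_betw_byWitness[where f' = "\<lambda>B. B - {i}"])
         (auto simp: finite_subset card_insert_if subset_Diff_insert)
    from bij_betw_same_card[OF this] show ?thesis
      using n_subsets[of "A - {i}" "b - 1"] that assms(1) by simp
  qed
  have "(\<Sum>B | B \<subseteq> A \<and> card B = b. \<Sum>i\<in>B. a i) =
      (\<Sum>B | B \<subseteq> A \<and> card B = b. \<Sum>i\<in>A. if i \<in> B then a i else 0)"
    by (rule sum.cong[OF refl]) (simp add: sum.inter_restrict[OF assms(1), symmetric] Int_absorb1)
  also have "\<dots> = (\<Sum>i\<in>A. \<Sum>B | B \<subseteq> A \<and> card B = b. if i \<in> B then a i else 0)"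
    by (rule sum.swap)
  also have "\<dots> = (\<Sum>i\<in>A. real (card A - 1 choose (b - 1)) * a i)"
    using fin count by (intro sum.cong refl) (simp add: sum.If_cases Collect_conj_eq[symmetric] conj_assoc)
  finally show ?thesis
    by (simp add: sum_distrib_left)
qed

text \<open>Unbiasedness of sampling without replacement. It is applied to function values and to
  inner products of gradients with a fixed vector, hence the real-valued \<open>a\<close>.\<close>

lemma expectation_sample_mean:
  assumes "finite A" "1 \<le> b" "b \<le> card A"
  shows "measure_pmf.expectation (pmf_of_set {B. B \<subseteq> A \<and> card B = b})
      (\<lambda>B. (\<Sum>i\<in>B. a i) / real (card B)) = (\<Sum>i\<in>A. a i) / real (card A)"
proof -
  let ?S = "{B. B \<subseteq> A \<and> card B = b}"
  have card: "card ?S = (card A choose b)"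
    using n_subsets[OF assms(1)] .
  have "?S \<noteq> {}"
    using assms(3) by (rule subsets_of_card_nonempty)
  moreover have "finite ?S"
    using assms(1) by simp
  ultimately have "measure_pmf.expectation (pmf_of_set ?S) (\<lambda>B. (\<Sum>i\<in>B. a i) / real (card B)) =
      (\<Sum>B\<in>?S. (\<Sum>i\<in>B. a i) / real (card B)) / real (card ?S)"
    by (intro integral_pmf_of_set)
  also have "\<dots> = (\<Sum>B\<in>?S. \<Sum>i\<in>B. a i) / real b / real (card A choose b)"
    by (simp add: card sum_divide_distrib)
  also have "\<dots> = real (card A - 1 choose (b - 1)) / real (b * (card A choose b)) * (\<Sum>i\<in>A. a i)"
    using assms by (simp add: sum_over_subsets_of_card)
  \<comment> \<open>The absorption identity. The common binomial coefficient then cancels, being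
    nonzero because \<open>1 \<le> b\<close> and \<open>b \<le> card A\<close>.\<close>
  also have "b * (card A choose b) = card A * (card A - 1 choose (b - 1))"
    using times_binomial_minus1_eq[of b "card A"] assms by simp
  also have "real (card A - 1 choose (b - 1)) / real (card A * (card A - 1 choose (b - 1))) = 1 / card A"
    using assms by simp
  finally show ?thesis
    by simp
qed

section \<open>Batch averages and a single inner step\<close>

lemma GDERIV_batch_mean:
  assumes "\<And>i. i \<in> B \<Longrightarrow> F i differentiable (at w)"
  shows "GDERIV (batch_mean F B) w :> (1 / real (card B)) *\<^sub>R (\<Sum>i\<in>B. gradient (F i) w)"
proof -
  have "(F i has_derivative (\<lambda>h. h \<bullet> gradient (F i) w)) (at w)" if "i \<in> B" for i
    using GDERIV_gradient[OF assms[OF that]] by (simp add: gderiv_def)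
  then have "((\<lambda>w. (1 / real (card B)) * (\<Sum>i\<in>B. F i w)) has_derivative
      (\<lambda>h. (1 / real (card B)) * (\<Sum>i\<in>B. h \<bullet> gradient (F i) w))) (at w)"
    by (intro has_derivative_mult_right has_derivative_sum)
  moreover have "batch_mean F B = (\<lambda>w. (1 / real (card B)) * (\<Sum>i\<in>B. F i w))"
    by (simp add: batch_mean_def fun_eq_iff)
  ultimately show ?thesis
    by (simp add: gderiv_def inner_sum_right)
qed

lemma gradient_batch_mean:
  assumes "\<And>i. i \<in> B \<Longrightarrow> F i differentiable (at w)"
  shows "gradient (batch_mean F B) w = (1 / real (card B)) *\<^sub>R (\<Sum>i\<in>B. gradient (F i) w)"
  using gradient_eqI[OF GDERIV_batch_mean] assms by blast

lemma norm_diff_sq_le: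
  fixes a b :: "'a::real_inner"
  shows "(norm (a - b))\<^sup>2 \<le> 2 * (norm a)\<^sup>2 + 2 * (norm b)\<^sup>2"
proof -
  have "0 \<le> (norm (a + b))\<^sup>2" by simp
  then show ?thesis
    by (simp add: power2_norm_eq_inner inner_add_left inner_add_right inner_diff_left
        inner_diff_right inner_commute)
qed

text \<open>Strong convexity stays outside the locale: the lemmas on steps and epochs receive it as
  the Polyak-Lojasiewicz hypothesis \<open>PL\<close>.\<close>

locale smooth_finite_sum =
  fixes F :: "nat \<Rightarrow> real^'d::finite \<Rightarrow> real" and n :: nat and L :: real and wstar :: "real^'d"
  assumes n_pos: "1 \<le> n" and L_pos: "0 < L"
    and convex_F: "i \<in> {1..n} \<Longrightarrow> convex_on UNIV (F i)"
    and differentiable_F: "i \<in> {1..n} \<Longrightarrow> F i differentiable (at w)"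
    and lipschitz_F: "i \<in> {1..n} \<Longrightarrow> L-lipschitz_on UNIV (gradient (F i))"
    and minimizer: "batch_mean F {1..n} wstar \<le> batch_mean F {1..n} w"
begin

abbreviation f :: "real^'d \<Rightarrow> real" where
  "f \<equiv> batch_mean F {1..n}"

abbreviation grad :: "nat set \<Rightarrow> real^'d \<Rightarrow> real^'d" where
  "grad B \<equiv> gradient (batch_mean F B)"

lemma GDERIV_grad:
  assumes "B \<subseteq> {1..n}"
  shows "GDERIV (batch_mean F B) w :> grad B w"
proof -
  have *: "F i differentiable (at w)" if "i \<in> B" for i
    using that assms differentiable_F by blast
  show ?thesis
    using GDERIV_batch_mean[OF *] gradient_batch_mean[OF *] by simp
qed

lemma grad_eq:
  assumes "B \<subseteq> {1..n}"
  shows "grad B w = (1 / real (card B)) *\<^sub>R (\<Sum>i\<in>B. gradient (F i) w)"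
  using assms differentiable_F by (intro gradient_batch_mean) blast

lemma convex_on_batch_mean:
  assumes "B \<subseteq> {1..n}"
  shows "convex_on UNIV (batch_mean F B)"
proof (rule convex_onI)
  fix t :: real and x y :: "real^'d" assume t: "0 < t" "t < 1"
  have "(\<Sum>i\<in>B. F i ((1 - t) *\<^sub>R x + t *\<^sub>R y)) \<le> (\<Sum>i\<in>B. (1 - t) * F i x + t * F i y)"
  proof (rule sum_mono)
    fix i assume "i \<in> B"
    then show "F i ((1 - t) *\<^sub>R x + t *\<^sub>R y) \<le> (1 - t) * F i x + t * F i y"
      using convex_onD[OF convex_F, of i t x y] assms t by auto
  qed
  then have "(1 / real (card B)) * (\<Sum>i\<in>B. F i ((1 - t) *\<^sub>R x + t *\<^sub>R y))
      \<le> (1 / real (card B)) * (\<Sum>i\<in>B. (1 - t) * F i x + t * F i y)"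
    by (intro mult_left_mono) auto
  then show "batch_mean F B ((1 - t) *\<^sub>R x + t *\<^sub>R y)
      \<le> (1 - t) * batch_mean F B x + t * batch_mean F B y"
    by (simp add: batch_mean_def sum.distrib sum_distrib_left[symmetric] add_divide_distrib)
qed simp

lemma lipschitz_on_grad:
  assumes "B \<subseteq> {1..n}"
  shows "L-lipschitz_on UNIV (grad B)"
proof (rule lipschitz_onI)
  fix x y :: "real^'d"
  have "norm (\<Sum>i\<in>B. gradient (F i) x - gradient (F i) y) \<le> (\<Sum>i\<in>B. L * dist x y)"
  proof (rule sum_norm_le)
    fix i assume "i \<in> B"
    then show "norm (gradient (F i) x - gradient (F i) y) \<le> L * dist x y"
      using assms lipschitz_onD[OF lipschitz_F, of i x y] by (auto simp: dist_norm)
  qed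
  then have "norm (\<Sum>i\<in>B. gradient (F i) x - gradient (F i) y) / real (card B) \<le>
      real (card B) * (L * dist x y) / real (card B)"
    by (intro divide_right_mono) auto
  \<comment> \<open>An inequality rather than an equation, since for empty \<open>B\<close> the
    quotient is 0 by convention.\<close>
  also have "\<dots> \<le> L * dist x y"
    using L_pos by simp
  finally show "dist (grad B x) (grad B y) \<le> L * dist x y"
    by (simp add: grad_eq[OF assms] dist_norm scaleR_diff_right[symmetric] sum_subtractf)
qed (use L_pos in simp)

lemma grad_minimizer: "grad {1..n} wstar = 0"
proof -
  have "(f has_derivative (\<lambda>h. h \<bullet> grad {1..n} wstar)) (at wstar)"
    using GDERIV_grad[of "{1..n}" wstar] by (simp add: gderiv_def)
  then have "(\<lambda>h. h \<bullet> grad {1..n} wstar) = (\<lambda>h. 0)"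
    by (rule has_derivative_local_min) (simp add: minimizer del: One_nat_def)
  then show ?thesis
    by (metis inner_eq_zero_iff)
qed

text \<open>
  The bracket following \<open>L * (\<eta> * \<delta>)\<^sup>2\<close> bounds half the squared norm of the variance-reduced
  gradient. Its cross term \<open>- 2 * \<dots>\<close> is kept because its expectation is
  \<open>- 2 * (norm (grad {1..n} w'))\<^sup>2\<close>; the whole bound is affine in the batch averages, so its
  expectation over the batch is its value at \<open>B = {1..n}\<close>.
\<close>

lemma svrg_step_le:
  assumes B: "B \<subseteq> {1..n}" and P: "\<And>v. norm (P *v v) \<le> \<delta> * norm v"
  shows "f (svrg_step n F \<eta> P w' B w) \<le>
    f w - \<eta> * (grad {1..n} w \<bullet> (P *v (grad B w - grad B w' + grad {1..n} w'))) +
    L * (\<eta> * \<delta>)\<^sup>2 *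
      (2 * L * (batch_mean F B w - batch_mean F B wstar - grad B wstar \<bullet> (w - wstar)) +
       2 * L * (batch_mean F B w' - batch_mean F B wstar - grad B wstar \<bullet> (w' - wstar)) -
       2 * ((grad B w' - grad B wstar) \<bullet> grad {1..n} w') + (norm (grad {1..n} w'))\<^sup>2)"
proof -
  define v where "v = grad B w - grad B w' + grad {1..n} w'"
  \<comment> \<open>Both batch gradients are centred at \<open>wstar\<close>, so that co-coercivity
    bounds \<open>p\<close> and \<open>q\<close> by Bregman divergences from \<open>wstar\<close>.
    The factor 2 lost in splitting \<open>v\<close> is compensated by the factor 1/2 of the descent
    lemma.\<close>
  define p where "p = grad B w - grad B wstar"
  define q where "q = grad B w' - grad B wstar"
  have bregman: "(norm (grad B x - grad B wstar))\<^sup>2 \<le>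
      2 * L * (batch_mean F B x - batch_mean F B wstar - grad B wstar \<bullet> (x - wstar))" for x
    using GDERIV_grad[OF B] lipschitz_on_grad[OF B] convex_on_batch_mean[OF B] L_pos
    by (rule gradient_difference_le_bregman)
  have "(norm v)\<^sup>2 = (norm (p - (q - grad {1..n} w')))\<^sup>2"
    by (simp add: v_def p_def q_def algebra_simps)
  also have "\<dots> \<le> 2 * (norm p)\<^sup>2 + 2 * (norm (q - grad {1..n} w'))\<^sup>2"
    by (rule norm_diff_sq_le)
  also have "(norm (q - grad {1..n} w'))\<^sup>2 =
      (norm q)\<^sup>2 - 2 * (q \<bullet> grad {1..n} w') + (norm (grad {1..n} w'))\<^sup>2"
    by (simp add: power2_norm_eq_inner inner_diff_left inner_diff_right inner_commute)
  finally have v: "(norm v)\<^sup>2 / 2 \<le>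
      2 * L * (batch_mean F B w - batch_mean F B wstar - grad B wstar \<bullet> (w - wstar)) +
      2 * L * (batch_mean F B w' - batch_mean F B wstar - grad B wstar \<bullet> (w' - wstar)) -
      2 * (q \<bullet> grad {1..n} w') + (norm (grad {1..n} w'))\<^sup>2"
    using bregman[of w] bregman[of w'] by (simp add: p_def q_def)
  have "(norm (\<eta> *\<^sub>R (P *v v)))\<^sup>2 \<le> (\<eta> * \<delta>)\<^sup>2 * (norm v)\<^sup>2"
    using mult_left_mono[OF power_mono[OF P[of v], of 2], of "\<eta>\<^sup>2"]
    by (simp add: power_mult_distrib mult.assoc)
  then have Pv: "L / 2 * (norm (\<eta> *\<^sub>R (P *v v)))\<^sup>2 \<le> L / 2 * ((\<eta> * \<delta>)\<^sup>2 * (norm v)\<^sup>2)"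
    using L_pos by (intro mult_left_mono) auto
  have step: "svrg_step n F \<eta> P w' B w = w - \<eta> *\<^sub>R (P *v v)"
    by (simp add: svrg_step_def v_def Let_def)
  have "f (svrg_step n F \<eta> P w' B w) \<le>
      f w + grad {1..n} w \<bullet> (- \<eta> *\<^sub>R (P *v v)) + L / 2 * (norm (\<eta> *\<^sub>R (P *v v)))\<^sup>2"
    using lipschitz_gradient_upper_bound[OF GDERIV_grad lipschitz_on_grad,
        of "{1..n}" "w - \<eta> *\<^sub>R (P *v v)" w]
    by (simp add: step)
  also have "\<dots> \<le> f w - \<eta> * (grad {1..n} w \<bullet> (P *v v)) + L * (\<eta> * \<delta>)\<^sup>2 * ((norm v)\<^sup>2 / 2)"
    using Pv by simp
  also have "\<dots> \<le> f w - \<eta> * (grad {1..n} w \<bullet> (P *v v)) + L * (\<eta> * \<delta>)\<^sup>2 *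
     (2 * L * (batch_mean F B w - batch_mean F B wstar - grad B wstar \<bullet> (w - wstar)) +
      2 * L * (batch_mean F B w' - batch_mean F B wstar - grad B wstar \<bullet> (w' - wstar)) -
      2 * (q \<bullet> grad {1..n} w') + (norm (grad {1..n} w'))\<^sup>2)"
    using v L_pos by (intro add_left_mono mult_left_mono) auto
  finally show ?thesis
    by (simp add: v_def q_def)
qed

lemma expectation_svrg_step_le:
  assumes b: "1 \<le> b" "b \<le> n" and "0 \<le> \<eta>"  and "0 \<le> \<Delta>"
    and P: "\<And>v. norm (P *v v) \<le> \<delta> * norm v"
    and P': "\<And>v. \<Delta> * (norm v)\<^sup>2 \<le> v \<bullet> (P *v v)"
    and PL: "2 * \<mu> * (f w - f wstar) \<le> (norm (grad {1..n} w))\<^sup>2"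
  shows "measure_pmf.expectation (pmf_of_set {B. B \<subseteq> {1..n} \<and> card B = b})
      (\<lambda>B. f (svrg_step n F \<eta> P w' B w)) - f wstar \<le>
    (1 - 2 * \<eta> * \<mu> * \<Delta>) * (f w - f wstar) +
    2 * \<eta>\<^sup>2 * L\<^sup>2 * \<delta>\<^sup>2 * ((f w - f wstar) + (f w' - f wstar))"
proof -
  let ?S = "{B. B \<subseteq> {1..n} \<and> card B = b}"
  let ?E = "measure_pmf.expectation (pmf_of_set ?S)"
  have S: "finite ?S" "?S \<noteq> {}"
    using b subsets_of_card_nonempty[of b "{1..n}"] by auto
  have int: "integrable (measure_pmf (pmf_of_set ?S)) h" for h :: "nat set \<Rightarrow> real"
    using S by (intro integrable_measure_pmf_finite) simp
  have mean: "?E (\<lambda>B. (\<Sum>i\<in>B. a i) / real (card B)) = (\<Sum>i\<in>{1..n}. a i) / real n" for a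
    using expectation_sample_mean[of "{1..n}" b a] b by simp
  have E1: "?E (\<lambda>B. batch_mean F B x) = f x" for x
    using mean[of "\<lambda>i. F i x"] by (simp add: batch_mean_def)
  have E2: "?E (\<lambda>B. u \<bullet> grad B x) = u \<bullet> grad {1..n} x" for u x
  proof -
    have inner: "u \<bullet> grad B x = (\<Sum>i\<in>B. u \<bullet> gradient (F i) x) / real (card B)"
      if "B \<subseteq> {1..n}" for B
      by (simp add: grad_eq[OF that] inner_sum_right)
    have "?E (\<lambda>B. u \<bullet> grad B x) = ?E (\<lambda>B. (\<Sum>i\<in>B. u \<bullet> gradient (F i) x) / real (card B))"
      using S by (intro integral_cong_AE) (auto simp: AE_measure_pmf_iff inner)
    then show ?thesis
      by (simp add: mean inner del: One_nat_def)
  qed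
  define g where "g = grad {1..n} w"
  define g' where "g' = grad {1..n} w'"
  define C where "C = L * (\<eta> * \<delta>)\<^sup>2"
  \<comment> \<open>Moving \<open>P\<close> onto the fixed gradient \<open>g\<close> makes the
    linear term an inner product of a constant vector with batch gradients, the shape
    \<open>E2\<close> handles.\<close>
  define u where "u = g v* P"
  have u: "g \<bullet> (P *v x) = u \<bullet> x" for x
    by (simp add: u_def dot_lmul_matrix)
  have "?E (\<lambda>B. f (svrg_step n F \<eta> P w' B w)) \<le> ?E (\<lambda>B.
      f w - \<eta> * (u \<bullet> grad B w - u \<bullet> grad B w' + u \<bullet> g') + C *
      (2 * L * (batch_mean F B w - batch_mean F B wstar - (w - wstar) \<bullet> grad B wstar) +
       2 * L * (batch_mean F B w' - batch_mean F B wstar - (w' - wstar) \<bullet> grad B wstar) -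
       2 * (g' \<bullet> grad B w' - g' \<bullet> grad B wstar) + (norm g')\<^sup>2))"
  proof (rule expectation_pmf_mono_finite)
    fix B assume "B \<in> set_pmf (pmf_of_set ?S)"
    then have "B \<subseteq> {1..n}"
      using S by simp
    have "g \<bullet> (P *v (grad B w - grad B w' + g')) = u \<bullet> grad B w - u \<bullet> grad B w' + u \<bullet> g'"
      by (simp add: u inner_add_right inner_diff_right)
    moreover have "grad B wstar \<bullet> x = x \<bullet> grad B wstar" for x
      by (rule inner_commute)
    moreover have "(grad B w' - grad B wstar) \<bullet> g' = g' \<bullet> grad B w' - g' \<bullet> grad B wstar"
      by (metis inner_commute inner_diff_right)
    moreover note svrg_step_le[OF \<open>B \<subseteq> {1..n}\<close> P, of \<eta> w' w, folded g_def g'_def C_def]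
    ultimately show "f (svrg_step n F \<eta> P w' B w) \<le>
      f w - \<eta> * (u \<bullet> grad B w - u \<bullet> grad B w' + u \<bullet> g') + C *
      (2 * L * (batch_mean F B w - batch_mean F B wstar - (w - wstar) \<bullet> grad B wstar) +
       2 * L * (batch_mean F B w' - batch_mean F B wstar - (w' - wstar) \<bullet> grad B wstar) -
       2 * (g' \<bullet> grad B w' - g' \<bullet> grad B wstar) + (norm g')\<^sup>2)"
      by metis
  qed (use S in simp)
  also have "\<dots> = f w - \<eta> * (u \<bullet> g) +
      C * (2 * L * (f w - f wstar) + 2 * L * (f w' - f wstar) - (norm g')\<^sup>2)"
    by (simp add: int E1 E2 grad_minimizer g_def[symmetric] g'_def[symmetric] dot_square_norm
        algebra_simps del: One_nat_def)
  also have "\<dots> \<le> f w - \<eta> * (\<Delta> * (norm g)\<^sup>2) +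
      C * (2 * L * (f w - f wstar) + 2 * L * (f w' - f wstar))"
    using P'[of g] \<open>0 \<le> \<eta>\<close> L_pos
    by (intro add_mono diff_mono mult_left_mono) (auto simp: u C_def)
  also have "\<dots> \<le> f w - \<eta> * (\<Delta> * (2 * \<mu> * (f w - f wstar))) +
      C * (2 * L * (f w - f wstar) + 2 * L * (f w' - f wstar))"
    using PL \<open>0 \<le> \<eta>\<close> \<open>0 \<le> \<Delta>\<close> by (intro add_right_mono diff_left_mono mult_left_mono) (auto simp: g_def)
  finally show ?thesis
    by (simp add: C_def algebra_simps power2_eq_square)
qed

end

section \<open>The inner loop and one epoch\<close>

lemma finite_set_pmf_svrg_inner:
  assumes "b \<le> n"
  shows "finite (set_pmf (svrg_inner n b F \<eta> P w' t))"
proof -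
  have "{B. B \<subseteq> {1..n} \<and> card B = b} \<noteq> {}"
    using assms by (intro subsets_of_card_nonempty) simp
  then show ?thesis
    by (induction t) auto
qed

lemma finite_set_pmf_svrg_epoch:
  assumes "b \<le> n" and "m \<le> CARD('d::finite)" and "1 \<le> l"
  shows "finite (set_pmf (svrg_epoch nys m n b F \<eta> \<rho> l (w' :: real^'d)))"
proof -
  have "{\<Omega> :: 'd set. card \<Omega> = m} \<noteq> {}"
    using assms subsets_of_card_nonempty[of m "UNIV :: 'd set"] by simp
  then show ?thesis
    using assms by (auto simp: svrg_epoch_def Let_def finite_set_pmf_svrg_inner)
qed

text \<open>Steps after \<open>t\<close> write only to later entries, so the law of
  \<open>w t\<close> does not depend on how far the trajectory is continued.\<close>

lemma expectation_svrg_inner_prefix: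
  fixes h :: "real^'d::finite \<Rightarrow> real"
  assumes "b \<le> n" and "t \<le> T"
  shows "measure_pmf.expectation (svrg_inner n b F \<eta> P w' T) (\<lambda>w. h (w t)) =
    measure_pmf.expectation (svrg_inner n b F \<eta> P w' t) (\<lambda>w. h (w t))"
  using assms(2)
proof (induction T rule: dec_induct)
  case (step T)
  have "{B. B \<subseteq> {1..n} \<and> card B = b} \<noteq> {}"
    using assms by (intro subsets_of_card_nonempty) simp
  with step show ?case
    by (simp add: expectation_bind_pmf_finite finite_set_pmf_svrg_inner[OF assms(1)])
qed simp

text \<open>
  Telescoping controls the averages over \<open>0, \<dots>, l - 1\<close>. The iterate is drawn from
  \<open>1, \<dots>, l\<close> instead, and this shift of the window is harmless because \<open>c \<le> 1\<close>.
\<close>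

lemma sum_le_of_linear_recursion:
  fixes A :: "nat \<Rightarrow> real"
  assumes rec: "\<And>t. A (Suc t) \<le> (1 - c) * A t + e * A 0"
    and "0 \<le> A l" "0 \<le> A 0" "0 < c" "c \<le> 1"
  shows "(\<Sum>t\<in>{1..l}. A t) \<le> (1 + real l * e) / c * A 0"
proof -
  \<comment> \<open>The induction closes because the new summand \<open>c * A (Suc l)\<close> and
    \<open>(1 - c) * A (Suc l)\<close> merge into \<open>A (Suc l)\<close>, to which
    \<open>rec\<close> applies.\<close>
  have "c * (\<Sum>t\<in>{1..l}. A t) + c * A 0 + (1 - c) * A l \<le> (1 + real l * e) * A 0" for l
  proof (induction l)
    case (Suc l)
    then show ?case
      using rec[of l] by (simp add: algebra_simps)
  qed (simp add: algebra_simps)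
  from this[of l] have "c * (\<Sum>t\<in>{1..l}. A t) \<le> (1 + real l * e) * A 0"
    using assms by (smt (verit) mult_nonneg_nonneg)
  then show ?thesis
    using \<open>0 < c\<close> by (simp add: field_simps)
qed

context smooth_finite_sum
begin

text \<open>The one-step bound averaged over the trajectory up to \<open>t\<close>. The share of the
  variance term at \<open>w t\<close> is absorbed into the contraction factor; the share at
  \<open>w'\<close> is \<open>A 0\<close>, as the trajectory starts there. This is the recursion
  that \<open>sum_le_of_linear_recursion\<close> takes.\<close>

lemma expectation_svrg_inner_Suc_le:
  fixes w' :: "real^'d"
  assumes b: "1 \<le> b" "b \<le> n" and "0 \<le> \<eta>" "0 \<le> \<Delta>"
    and P: "\<And>v. norm (P *v v) \<le> \<delta> * norm v" "\<And>v. \<Delta> * (norm v)\<^sup>2 \<le> v \<bullet> (P *v v)"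
    and PL: "\<And>w. 2 * \<mu> * (f w - f wstar) \<le> (norm (grad {1..n} w))\<^sup>2"
  defines "A \<equiv> \<lambda>t. measure_pmf.expectation (svrg_inner n b F \<eta> P w' t) (\<lambda>w. f (w t) - f wstar)"
  shows "A (Suc t) \<le> (1 - 2 * \<eta> * (\<mu> * \<Delta> - \<eta> * L\<^sup>2 * \<delta>\<^sup>2)) * A t + 2 * \<eta>\<^sup>2 * L\<^sup>2 * \<delta>\<^sup>2 * A 0"
proof -
  let ?S = "{B. B \<subseteq> {1..n} \<and> card B = b}"
  let ?p = "svrg_inner n b F \<eta> P w' t"
  have S: "finite ?S" "?S \<noteq> {}"
    using b subsets_of_card_nonempty[of b "{1..n}"] by auto
  have fin: "finite (set_pmf ?p)"
    by (rule finite_set_pmf_svrg_inner[OF b(2)])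
  have int: "integrable (measure_pmf ?p) h" for h :: "_ \<Rightarrow> real"
    by (rule integrable_measure_pmf_finite[OF fin])
  have int_S: "integrable (measure_pmf (pmf_of_set ?S)) h" for h :: "nat set \<Rightarrow> real"
    using S by (intro integrable_measure_pmf_finite) simp
  have "A (Suc t) = measure_pmf.expectation ?p (\<lambda>w.
      measure_pmf.expectation (pmf_of_set ?S) (\<lambda>B. f (svrg_step n F \<eta> P w' B (w t))) - f wstar)"
    unfolding A_def svrg_inner.simps using S fin
    by (simp add: expectation_bind_pmf_finite int_S del: One_nat_def)
  also have "\<dots> \<le> measure_pmf.expectation ?p (\<lambda>w.
      (1 - 2 * \<eta> * \<mu> * \<Delta>) * (f (w t) - f wstar) +
      2 * \<eta>\<^sup>2 * L\<^sup>2 * \<delta>\<^sup>2 * ((f (w t) - f wstar) + (f w' - f wstar)))"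
    using b \<open>0 \<le> \<eta>\<close> \<open>0 \<le> \<Delta>\<close> P PL
    by (intro expectation_pmf_mono_finite[OF fin] expectation_svrg_step_le)
  also have "\<dots> = (1 - 2 * \<eta> * \<mu> * \<Delta>) * A t + 2 * \<eta>\<^sup>2 * L\<^sup>2 * \<delta>\<^sup>2 * (A t + A 0)"
    by (simp add: A_def int algebra_simps del: One_nat_def)
  finally show ?thesis
    by (simp add: algebra_simps power2_eq_square)
qed

text \<open>For fixed \<open>\<Omega>\<close> the random index averages \<open>A 1\<close> to
  \<open>A l\<close>, and dividing the bound of \<open>sum_le_of_linear_recursion\<close> by
  \<open>l\<close> produces the stated factor. It is the same for every \<open>\<Omega>\<close>, so
  averaging over \<open>\<Omega>\<close> preserves it.\<close>

lemma expectation_svrg_epoch_le: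
  assumes b: "1 \<le> b" "b \<le> n" and "0 < \<eta>" "0 \<le> \<Delta>" "1 \<le> l" and m: "m \<le> CARD('d)"
    and P: "\<And>\<Omega> v. card \<Omega> = m \<Longrightarrow> norm (precond \<rho> (nys (hessian f w') \<Omega>) *v v) \<le> \<delta> * norm v"
      "\<And>\<Omega> v. card \<Omega> = m \<Longrightarrow> \<Delta> * (norm v)\<^sup>2 \<le> v \<bullet> (precond \<rho> (nys (hessian f w') \<Omega>) *v v)"
    and PL: "\<And>w. 2 * \<mu> * (f w - f wstar) \<le> (norm (grad {1..n} w))\<^sup>2"
    and "0 < \<mu> * \<Delta> - \<eta> * L\<^sup>2 * \<delta>\<^sup>2" and "2 * \<eta> * (\<mu> * \<Delta> - \<eta> * L\<^sup>2 * \<delta>\<^sup>2) \<le> 1"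
  shows "measure_pmf.expectation (svrg_epoch nys m n b F \<eta> \<rho> l w') (\<lambda>w. f w - f wstar) \<le>
    (1 + 2 * real l * \<eta>\<^sup>2 * L\<^sup>2 * \<delta>\<^sup>2) / (2 * real l * \<eta> * (\<mu> * \<Delta> - \<eta> * L\<^sup>2 * \<delta>\<^sup>2)) *
    (f w' - f wstar)"
proof -
  let ?S = "{\<Omega> :: 'd set. card \<Omega> = m}"
  let ?P = "\<lambda>\<Omega>. precond \<rho> (nys (hessian f w') \<Omega>)"
  let ?\<alpha> = "(1 + 2 * real l * \<eta>\<^sup>2 * L\<^sup>2 * \<delta>\<^sup>2) / (2 * real l * \<eta> * (\<mu> * \<Delta> - \<eta> * L\<^sup>2 * \<delta>\<^sup>2))"
  have S: "finite ?S" "?S \<noteq> {}"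
    using m subsets_of_card_nonempty[of m "UNIV :: 'd set"] by auto
  note fin = finite_set_pmf_svrg_inner[OF b(2)]
  define draw where "draw w = map_pmf w (pmf_of_set {1..l})" for w :: "nat \<Rightarrow> real^'d"
  have l: "finite {1..l}" "{1..l} \<noteq> {}"
    using \<open>1 \<le> l\<close> by auto
  have fin_draw: "finite (set_pmf (draw w))" for w
    using l by (simp add: draw_def)
  have E_draw: "measure_pmf.expectation (draw w) h = (\<Sum>t\<in>{1..l}. h (w t)) / real l"
    for w and h :: "real^'d \<Rightarrow> real"
    using l by (simp add: draw_def integral_pmf_of_set del: One_nat_def)
  have fin_inner: "finite (set_pmf (svrg_inner n b F \<eta> (?P \<Omega>) w' l \<bind> draw))" for \<Omega>
    by (simp add: fin fin_draw)
  have "svrg_epoch nys m n b F \<eta> \<rho> l w' =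
      pmf_of_set ?S \<bind> (\<lambda>\<Omega>. svrg_inner n b F \<eta> (?P \<Omega>) w' l \<bind> draw)"
    by (simp add: svrg_epoch_def Let_def draw_def[abs_def] map_pmf_def)
  then have "measure_pmf.expectation (svrg_epoch nys m n b F \<eta> \<rho> l w') (\<lambda>w. f w - f wstar) =
    measure_pmf.expectation (pmf_of_set ?S) (\<lambda>\<Omega>.
      measure_pmf.expectation (svrg_inner n b F \<eta> (?P \<Omega>) w' l) (\<lambda>w.
        (\<Sum>t\<in>{1..l}. f (w t) - f wstar) / real l))"
    using S by (simp add: expectation_bind_pmf_finite fin fin_inner fin_draw E_draw del: One_nat_def)
  also have "\<dots> \<le> measure_pmf.expectation (pmf_of_set ?S) (\<lambda>\<Omega>. ?\<alpha> * (f w' - f wstar))"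
  proof (rule expectation_pmf_mono_finite)
    fix \<Omega> assume "\<Omega> \<in> set_pmf (pmf_of_set ?S)"
    then have \<Omega>: "card \<Omega> = m"
      using S by simp
    define A where "A t = measure_pmf.expectation (svrg_inner n b F \<eta> (?P \<Omega>) w' t)
        (\<lambda>w. f (w t) - f wstar)" for t
    have "(\<Sum>t\<in>{1..l}. A t) \<le>
        (1 + real l * (2 * \<eta>\<^sup>2 * L\<^sup>2 * \<delta>\<^sup>2)) / (2 * \<eta> * (\<mu> * \<Delta> - \<eta> * L\<^sup>2 * \<delta>\<^sup>2)) * A 0"
    proof (rule sum_le_of_linear_recursion)
      show "A (Suc t) \<le> (1 - 2 * \<eta> * (\<mu> * \<Delta> - \<eta> * L\<^sup>2 * \<delta>\<^sup>2)) * A t + 2 * \<eta>\<^sup>2 * L\<^sup>2 * \<delta>\<^sup>2 * A 0" for t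
        unfolding A_def using b \<open>0 < \<eta>\<close> \<open>0 \<le> \<Delta>\<close> P[OF \<Omega>] PL
        by (intro expectation_svrg_inner_Suc_le) auto
      show "0 \<le> A l" "0 \<le> A 0"
        unfolding A_def using minimizer by (auto intro!: integral_nonneg simp del: One_nat_def)
    qed (use assms in auto)
    then have "(\<Sum>t\<in>{1..l}. A t) / real l \<le>
        (1 + real l * (2 * \<eta>\<^sup>2 * L\<^sup>2 * \<delta>\<^sup>2)) / (2 * \<eta> * (\<mu> * \<Delta> - \<eta> * L\<^sup>2 * \<delta>\<^sup>2)) * A 0 / real l"
      by (intro divide_right_mono) auto
    also have "\<dots> = ?\<alpha> * A 0"
      by (simp add: ac_simps)
    also have "A 0 = f w' - f wstar"
      by (simp add: A_def)
    \<comment> \<open>The \<open>A t\<close> are expectations over trajectories of different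
      lengths; passing to the common length \<open>l\<close> allows sum and expectation to be
      exchanged.\<close>
    also have "(\<Sum>t\<in>{1..l}. A t) =
        (\<Sum>t\<in>{1..l}. measure_pmf.expectation (svrg_inner n b F \<eta> (?P \<Omega>) w' l) (\<lambda>w. f (w t) - f wstar))"
      unfolding A_def
      using expectation_svrg_inner_prefix[OF b(2), of _ l F \<eta> "?P \<Omega>" w' "\<lambda>w. f w - f wstar"]
      by (intro sum.cong refl) simp
    also have "\<dots> = measure_pmf.expectation (svrg_inner n b F \<eta> (?P \<Omega>) w' l)
        (\<lambda>w. \<Sum>t\<in>{1..l}. f (w t) - f wstar)"
      by (intro Bochner_Integration.integral_sum[symmetric] integrable_measure_pmf_finite fin)
    finally show "measure_pmf.expectation (svrg_inner n b F \<eta> (?P \<Omega>) w' l)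
        (\<lambda>w. (\<Sum>t\<in>{1..l}. f (w t) - f wstar) / real l) \<le> ?\<alpha> * (f w' - f wstar)"
      by simp
  qed (use S in simp)
  finally show ?thesis
    by simp
qed

end

section \<open>Contraction over the epochs\<close>

theorem theorem3:
  fixes F :: "nat \<Rightarrow> real^'d \<Rightarrow> real" and f :: "real^'d \<Rightarrow> real"
    and nys :: "real^'d^'d \<Rightarrow> 'd::finite set \<Rightarrow> real^'d^'d"
    and n b k l :: nat
    and \<mu> \<Lambda> \<eta> \<rho> \<Gamma> \<Delta> \<delta> \<alpha> :: real
    and w0 wstar :: "real^'d"
  assumes "n \<ge> 1"
    and f_eq: "f = batch_mean F {1..n}"
    and "\<mu> > 0" and "\<Lambda> > 0"
    and convex: "\<And>i. i \<in> {1..n} \<Longrightarrow> convex_on UNIV (F i)"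
    and smooth: "\<And>i. i \<in> {1..n} \<Longrightarrow> twice_continuously_differentiable (F i)"
    and hess_bounds: "\<And>w. loewner_le (\<mu> *\<^sub>R mat 1) (hessian f w) \<and>
                            loewner_le (hessian f w) (\<Lambda> *\<^sub>R mat 1)"
    and lipschitz: "\<And>i. i \<in> {1..n} \<Longrightarrow> \<Lambda>-lipschitz_on UNIV (gradient (F i))"
    and minimizer: "\<And>w. f wstar \<le> f w"
    and "\<eta> > 0" and "\<rho> > 0" and "l \<ge> 1"
    and batch_size: "1 \<le> b" "b \<le> n"
    and columns: "CARD('m::finite) \<le> CARD('d)" and rank: "k \<le> CARD('m)"
    and nystrom: "\<And>H \<Omega>. psd H \<Longrightarrow> card \<Omega> = CARD('m) \<Longrightarrow>
        \<exists>c :: 'm \<Rightarrow> 'd. bij_betw c UNIV \<Omega> \<and> is_nystrom_approx k c H (nys H \<Omega>)"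
    and "\<Gamma> \<ge> 0"
    and nystrom_bounds:
      "\<And>\<tau> w \<Omega>. w \<in> set_pmf (nystrom_svrg nys CARD('m) n b F \<eta> \<rho> l w0 \<tau>) \<Longrightarrow>
         card \<Omega> = CARD('m) \<Longrightarrow>
         loewner_le 0 (nys (hessian f w) \<Omega>) \<and>
         loewner_le (nys (hessian f w) \<Omega>) (\<Gamma> *\<^sub>R mat 1)"
    and "\<Delta> = 1 / (\<Gamma> + \<rho>)" and "\<delta> = 1 / \<rho>"
    and "\<eta> < \<mu> * \<Delta> / (2 * \<Lambda>^2 * \<delta>^2)"
    and "1 / (2 * real l * \<eta>) + 2 * \<eta> * \<Lambda>^2 * \<delta>^2 < \<mu> * \<Delta>"
    and "\<alpha> = (1 + 2 * real l * \<eta>^2 * \<Lambda>^2 * \<delta>^2) /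
              (2 * real l * \<eta> * (\<mu> * \<Delta> - \<eta> * \<Lambda>^2 * \<delta>^2))"
  shows "\<alpha> < 1 \<and>
    (\<forall>\<tau>. measure_pmf.expectation (nystrom_svrg nys CARD('m) n b F \<eta> \<rho> l w0 \<tau>)
             (\<lambda>w. f w - f wstar)
          \<le> \<alpha>^\<tau> * measure_pmf.expectation (nystrom_svrg nys CARD('m) n b F \<eta> \<rho> l w0 0)
             (\<lambda>w. f w - f wstar))"
proof -
  note l_large = \<open>1 / (2 * real l * \<eta>) + 2 * \<eta> * \<Lambda>\<^sup>2 * \<delta>\<^sup>2 < \<mu> * \<Delta>\<close>
    and \<alpha>_eq = \<open>\<alpha> = (1 + 2 * real l * \<eta>\<^sup>2 * \<Lambda>\<^sup>2 * \<delta>\<^sup>2) /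
      (2 * real l * \<eta> * (\<mu> * \<Delta> - \<eta> * \<Lambda>\<^sup>2 * \<delta>\<^sup>2))\<close>
  have diff_F: "F i differentiable (at w)" "gradient (F i) differentiable (at w)"
    if "i \<in> {1..n}" for i w
    using smooth[OF that] by (auto simp: twice_continuously_differentiable_def)
  interpret smooth_finite_sum F n \<Lambda> wstar
    rewrites "batch_mean F {1..n} = f"
  proof -
    show "smooth_finite_sum F n \<Lambda> wstar"
      using \<open>n \<ge> 1\<close> \<open>\<Lambda> > 0\<close> convex diff_F lipschitz minimizer f_eq
      by unfold_locales (auto simp del: One_nat_def)
  qed (rule f_eq[symmetric])
  have "f differentiable (at w)" for w
    using GDERIV_grad[of "{1..n}" w] unfolding f_eq gderiv_def differentiable_def by blast
  moreover have "gradient f differentiable (at w)" for w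
  proof -
    have "gradient f = (\<lambda>w. (1 / real n) *\<^sub>R (\<Sum>i\<in>{1..n}. gradient (F i) w))"
      using grad_eq[of "{1..n}", folded f_eq] by (simp add: fun_eq_iff)
    moreover have "(\<lambda>w. (1 / real n) *\<^sub>R (\<Sum>i\<in>{1..n}. gradient (F i) w)) differentiable (at w)"
      using diff_F by (intro differentiable_scaleR differentiable_const differentiable_sum) auto
    ultimately show ?thesis
      by simp
  qed
  ultimately have PL: "2 * \<mu> * (f w - f wstar) \<le> (norm (gradient f w))\<^sup>2" for w
    using hess_bounds \<open>\<mu> > 0\<close>
    by (intro polyak_lojasiewicz[OF hessian_lower_bound_imp_strongly_convex[of f \<mu> w wstar]]) auto

  \<comment> \<open>Both Hessian bounds are compared on a unit vector; the result serves to show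
    \<open>c_le\<close>.\<close>
  have "\<mu> \<le> \<Lambda>"
  proof -
    define x :: "real^'d" where "x = axis undefined 1"
    have "0 \<le> x \<bullet> ((hessian f w0 - \<mu> *\<^sub>R mat 1) *v x)"
      "0 \<le> x \<bullet> ((\<Lambda> *\<^sub>R mat 1 - hessian f w0) *v x)"
      using hess_bounds by (auto simp: loewner_le_def psd_def)
    then have "0 \<le> (\<Lambda> - \<mu>) * (x \<bullet> x)"
      by (simp add: matrix_vector_mult_diff_rdistrib scaleR_matrix_vector_assoc[symmetric]
          inner_diff_right left_diff_distrib)
    then show ?thesis
      by (simp add: x_def inner_axis_axis)
  qed
  have "\<Delta> \<le> \<delta>" "0 < \<Delta>" "0 < \<delta>"
    using assms by (auto simp: frac_le)
  have "\<mu> * \<Delta> \<le> \<Lambda> * \<delta>"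
    using \<open>\<mu> \<le> \<Lambda>\<close> \<open>\<Delta> \<le> \<delta>\<close> \<open>0 < \<Delta>\<close> \<open>\<mu> > 0\<close> by (intro mult_mono) auto
  have c_pos: "0 < \<mu> * \<Delta> - \<eta> * \<Lambda>\<^sup>2 * \<delta>\<^sup>2"
  proof -
    have "0 \<le> 1 / (2 * real l * \<eta>)" "0 \<le> \<eta> * \<Lambda>\<^sup>2 * \<delta>\<^sup>2"
      using \<open>\<eta> > 0\<close> by auto
    then show ?thesis
      using l_large \<open>l \<ge> 1\<close> by linarith
  qed
  have c_le: "2 * \<eta> * (\<mu> * \<Delta> - \<eta> * \<Lambda>\<^sup>2 * \<delta>\<^sup>2) \<le> 1"
  proof -
    \<comment> \<open>Since \<open>\<mu> * \<Delta> \<le> \<Lambda> * \<delta>\<close>, the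
      left-hand side is at most \<open>2 * s - 2 * s\<^sup>2\<close>, and 1 minus this is the sum of
      squares \<open>(s - 1)\<^sup>2 + s\<^sup>2\<close>.\<close>
    define s where "s = \<eta> * (\<Lambda> * \<delta>)"
    have "2 * \<eta> * (\<mu> * \<Delta> - \<eta> * \<Lambda>\<^sup>2 * \<delta>\<^sup>2) \<le> 2 * s - 2 * s\<^sup>2"
      using mult_left_mono[OF \<open>\<mu> * \<Delta> \<le> \<Lambda> * \<delta>\<close>, of \<eta>] \<open>\<eta> > 0\<close>
      by (simp add: s_def algebra_simps power2_eq_square)
    moreover have "0 \<le> (s - 1)\<^sup>2 + s\<^sup>2"
      by simp
    ultimately show ?thesis
      by (simp add: power2_eq_square algebra_simps)
  qed

  have denom: "0 < 2 * real l * \<eta> * (\<mu> * \<Delta> - \<eta> * \<Lambda>\<^sup>2 * \<delta>\<^sup>2)"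
    using c_pos \<open>l \<ge> 1\<close> \<open>\<eta> > 0\<close> by simp
  have "\<alpha> < 1"
  proof -
    \<comment> \<open>The condition on \<open>l\<close> is multiplied by
      \<open>2 * real l * \<eta>\<close>; moving half of the resulting quadratic term to the right
      gives numerator below denominator.\<close>
    have "2 * real l * \<eta> * (1 / (2 * real l * \<eta>) + 2 * \<eta> * \<Lambda>\<^sup>2 * \<delta>\<^sup>2) < 2 * real l * \<eta> * (\<mu> * \<Delta>)"
      using l_large \<open>l \<ge> 1\<close> \<open>\<eta> > 0\<close> by (intro mult_strict_left_mono) auto
    then have "1 + 2 * real l * \<eta>\<^sup>2 * \<Lambda>\<^sup>2 * \<delta>\<^sup>2 < 2 * real l * \<eta> * (\<mu> * \<Delta> - \<eta> * \<Lambda>\<^sup>2 * \<delta>\<^sup>2)"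
      using \<open>l \<ge> 1\<close> \<open>\<eta> > 0\<close> by (simp add: algebra_simps power2_eq_square)
    then show ?thesis
      using denom \<alpha>_eq by simp
  qed
  have "0 \<le> \<alpha>"
    using denom \<alpha>_eq by simp

  let ?X = "nystrom_svrg nys CARD('m) n b F \<eta> \<rho> l w0"
  have fin_epoch: "finite (set_pmf (svrg_epoch nys CARD('m) n b F \<eta> \<rho> l w'))" for w'
    using batch_size columns \<open>l \<ge> 1\<close> by (intro finite_set_pmf_svrg_epoch)
  have fin: "finite (set_pmf (?X \<tau>))" for \<tau>
    using fin_epoch by (induction \<tau>) auto
  \<comment> \<open>Restricted to the support of the outer iterate, because the Nystrom bounds are
    assumed at reachable points.\<close>
  have epoch: "measure_pmf.expectation (svrg_epoch nys CARD('m) n b F \<eta> \<rho> l w') (\<lambda>w. f w - f wstar)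
      \<le> \<alpha> * (f w' - f wstar)" if "w' \<in> set_pmf (?X \<tau>)" for w' \<tau>
    unfolding \<alpha>_eq
  proof (rule expectation_svrg_epoch_le)
    fix \<Omega> :: "'d set" and v :: "real^'d" assume "card \<Omega> = CARD('m)"
    then have N: "loewner_le 0 (nys (hessian f w') \<Omega>)"
      "loewner_le (nys (hessian f w') \<Omega>) (\<Gamma> *\<^sub>R mat 1)"
      using nystrom_bounds that by blast+
    show "norm (precond \<rho> (nys (hessian f w') \<Omega>) *v v) \<le> \<delta> * norm v"
      using precond_bounds(1)[OF N \<open>\<rho> > 0\<close>] \<open>\<delta> = 1 / \<rho>\<close> by simp
    show "\<Delta> * (norm v)\<^sup>2 \<le> v \<bullet> (precond \<rho> (nys (hessian f w') \<Omega>) *v v)"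
      using precond_bounds(2)[OF N \<open>\<rho> > 0\<close>] \<open>\<Delta> = 1 / (\<Gamma> + \<rho>)\<close> by simp
  qed (use batch_size columns \<open>l \<ge> 1\<close> \<open>\<eta> > 0\<close> \<open>0 < \<Delta>\<close> PL c_pos c_le in auto)
  have "measure_pmf.expectation (?X \<tau>) (\<lambda>w. f w - f wstar) \<le> \<alpha> ^ \<tau> * (f w0 - f wstar)" for \<tau>
  proof (induction \<tau>)
    case (Suc \<tau>)
    have "measure_pmf.expectation (?X (Suc \<tau>)) (\<lambda>w. f w - f wstar) =
        measure_pmf.expectation (?X \<tau>) (\<lambda>w'.
          measure_pmf.expectation (svrg_epoch nys CARD('m) n b F \<eta> \<rho> l w') (\<lambda>w. f w - f wstar))"
      unfolding nystrom_svrg.simps by (rule expectation_bind_pmf_finite[OF fin fin_epoch])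
    also have "\<dots> \<le> measure_pmf.expectation (?X \<tau>) (\<lambda>w'. \<alpha> * (f w' - f wstar))"
      using epoch by (rule expectation_pmf_mono_finite[OF fin])
    also have "\<dots> = \<alpha> * measure_pmf.expectation (?X \<tau>) (\<lambda>w'. f w' - f wstar)"
      by (rule integral_mult_right_zero)
    also have "\<dots> \<le> \<alpha> * (\<alpha> ^ \<tau> * (f w0 - f wstar))"
      using Suc.IH \<open>0 \<le> \<alpha>\<close> by (rule mult_left_mono)
    finally show ?case
      by simp
  qed simp
  then show ?thesis
    using \<open>\<alpha> < 1\<close> by simp
qed

end
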